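(* Let $R$ be an infinite skew field and let $\{H_1,H_2,\ldots,H_t\}$ be a finite family of proper subskew fields of $R$. Then: (i) the additive group of $R$ cannot be covered by finitely many cosets of the additive groups of $H_1,\ldots,H_t$; that is, $R$ is not a union of finitely many sets of the form $a+H_i$ with $a\in R$ and $1\le i\le t$; (ii) the group of units $U(R)$ cannot be covered by finitely many cosets of the unit groups $U(H_1),\ldots,U(H_t)$; that is, $U(R)$ is neither a union of finitely many left cosets $a\,U(H_i)$ nor a union of finitely many right cosets $U(H_i)\,a$, with $a\in U(R)$ and $1\le i\le t$.
   Context: A skew field is a (not necessarily commutative) division ring; a subskew field of $R$ is a subring containing $1$ which is itself a skew field, and it is proper if it is different from $R$. For a skew field $K$, $U(K)=K\setminus\{0\}$ denotes its multiplicative group of units. Several cosets of the same $H_i$ (or $U(H_i)$) may be used in a cover. *)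

theory Defs
  imports "HOL-Algebra.Algebra"
begin

locale skew_field = ring +
  assumes one_not_zero: "\<one> \<noteq> \<zero>"
    and skew_field_Units: "Units R = carrier R - {\<zero>}"

definition subskew_field :: "'a set \<Rightarrow> ('a, 'b) ring_scheme \<Rightarrow> bool"
  where "subskew_field H R \<longleftrightarrow> subring H R \<and> skew_field (R\<lparr>carrier := H\<rparr>)"

definition proper_subskew_field :: "'a set \<Rightarrow> ('a, 'b) ring_scheme \<Rightarrow> bool"
  where "proper_subskew_field H R \<longleftrightarrow> subskew_field H R \<and> H \<noteq> carrier R"

text \<open>The units are taken inside \<open>H\<close>: inverses are required to lie in \<open>H\<close>.\<close>

definition sub_units :: "('a, 'b) ring_scheme \<Rightarrow> 'a set \<Rightarrow> 'a set"
  where "sub_units R H = Units (R\<lparr>carrier := H\<rparr>)"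

lemma sub_units_eq:
  assumes "subskew_field H R"
  shows "sub_units R H = H - {\<zero>\<^bsub>R\<^esub>}"
  using assms skew_field.skew_field_Units[of "R\<lparr>carrier := H\<rparr>"]
  by (simp add: subskew_field_def sub_units_def)

end

theory Submission
  imports Defs
begin

text \<open>
  The theorem rests on B. H. Neumann's lemma: a group is never a finite union of cosets of
  subgroups of infinite index (\<open>not_covered_by_infinite_index_cosets\<close>). It therefore suffices to
  show that the subgroups involved have infinite index, and all three covering statements can be
  read in the additive group of \<open>R\<close>.

  A proper subskew field \<open>H\<close> has infinite additive index. If \<open>H\<close> is finite, this is because \<open>R\<close> is
  infinite. If \<open>H\<close> is infinite, pick \<open>y \<notin> H\<close>; the elements \<open>y h\<close> with \<open>h \<in> H\<close> lie in pairwise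
  distinct cosets of \<open>H\<close>, since \<open>y h - y h' \<in> H\<close> with \<open>h \<noteq> h'\<close> could be divided by \<open>h - h'\<close> to give
  \<open>y \<in> H\<close>. In other words, \<open>R / H\<close> is a nonzero right vector space over an infinite skew field, hence
  infinite.

  For the unit groups, note that \<open>a U(H)\<close> is contained in \<open>a H\<close>, which is again an additive
  subgroup of \<open>R\<close>, the image of \<open>H\<close> under the injective additive map \<open>x \<mapsto> a x\<close>; hence it has
  infinite additive index too. In the same way \<open>U(H) a\<close> is contained in \<open>H a\<close>. A finite cover of
  \<open>U(R)\<close> by such sets, together with the trivial subgroup \<open>{0}\<close>, would be a finite cover of the
  additive group of \<open>R\<close> by subgroups of infinite index.
\<close>

section \<open>Coverings of groups by cosets\<close>

text \<open>
  Induction on the number of subgroups. Single out one of them, \<open>K\<close>. As it has infinitely many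
  cosets in the group but only finitely many in the cover, some coset
  \<open>g K\<close> is not a member of the cover. It is disjoint from the other cosets of \<open>K\<close>, so it is covered by
  the cosets of the remaining subgroups. Translating that cover, every coset of \<open>K\<close> is covered by
  finitely many cosets of the remaining subgroups, and \<open>K\<close> can be eliminated.
\<close>

lemma (in group) Neumann_covering:
  assumes "finite S"
    and "\<And>K. K \<in> S \<Longrightarrow> subgroup K G \<and> infinite (lcosets K)"
    and "finite \<C>" and "\<C> \<subseteq> (\<Union>K\<in>S. lcosets K)"
  shows "\<not> carrier G \<subseteq> \<Union>\<C>"
  using assms
proof (induction S arbitrary: \<C> rule: finite_induct)
  case empty
  then show ?case by auto
next
  case (insert K S)
  have K: "subgroup K G" "infinite (lcosets K)" using insert.prems by auto
  have Ssub: "L \<subseteq> carrier G" if "L \<in> S" for L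
    using that insert.prems by (auto dest: subgroup.subset)
  have "lcosets K - \<C> \<noteq> {}"
    using K(2) insert.prems(2) by (metis Diff_eq_empty_iff finite_subset)
  then obtain g where g: "g \<in> carrier G" "g <# K \<notin> \<C>"
    unfolding LCOSETS_def by auto
  define E where "E = \<C> \<inter> (\<Union>L\<in>S. lcosets L)"
  define f where "f c = (SOME a. a \<in> carrier G \<and> c = a <# K)" for c
  have f: "f c \<in> carrier G \<and> c = f c <# K" if "c \<in> lcosets K" for c
  proof -
    have "\<exists>a. a \<in> carrier G \<and> c = a <# K" using that by (auto simp: LCOSETS_def)
    then show ?thesis unfolding f_def by (rule someI_ex)
  qed
  \<comment> \<open>Members of the cover other than cosets of \<open>K\<close> may be translated within the family for \<open>S\<close>,
    since a translate of a left coset is a left coset of the same subgroup.\<close>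
  have E_shift: "x <# e \<in> (\<Union>L\<in>S. lcosets L)" if "x \<in> carrier G" "e \<in> E" for x e
  proof -
    obtain L b where L: "L \<in> S" "b \<in> carrier G" "e = b <# L"
      using \<open>e \<in> E\<close> by (auto simp: E_def LCOSETS_def)
    then have "x <# e = (x \<otimes> b) <# L"
      using lcos_m_assoc[OF Ssub[OF L(1)] \<open>x \<in> carrier G\<close>] by auto
    then show ?thesis using L \<open>x \<in> carrier G\<close> by (auto simp: LCOSETS_def)
  qed
  \<comment> \<open>Translation by \<open>f c \<otimes> inv g\<close> carries the missing coset \<open>g K\<close> onto \<open>c\<close>.\<close>
  define \<C>' where "\<C>' = E \<union> (\<Union>c\<in>\<C> \<inter> lcosets K. (\<lambda>e. (f c \<otimes> inv g) <# e) ` E)"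
  have "finite \<C>'" unfolding \<C>'_def E_def using insert.prems(2) by auto
  moreover have "\<C>' \<subseteq> (\<Union>L\<in>S. lcosets L)"
  proof -
    have "(f c \<otimes> inv g) <# e \<in> (\<Union>L\<in>S. lcosets L)" if "c \<in> lcosets K" "e \<in> E" for c e
      using E_shift[OF _ that(2)] f[OF that(1)] g(1) by simp
    moreover have "E \<subseteq> (\<Union>L\<in>S. lcosets L)" unfolding E_def by (rule Int_lower2)
    ultimately show ?thesis unfolding \<C>'_def by blast
  qed
  ultimately have not_cov: "\<not> carrier G \<subseteq> \<Union>\<C>'"
    using insert.IH insert.prems(1) by auto
  show ?case
  proof
    assume cov: "carrier G \<subseteq> \<Union>\<C>"
    have gK: "g <# K \<subseteq> \<Union>E"
    proof
      fix x assume x: "x \<in> g <# K"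
      then have "x \<in> carrier G"
        using g(1) K(1) l_coset_subset_G subgroup.subset by blast
      then obtain c where c: "c \<in> \<C>" "x \<in> c" using cov by auto
      have "g <# K \<in> lcosets K" using g(1) unfolding LCOSETS_def by auto
      then have "c \<notin> lcosets K"
        using lcos_disjoint[OF K(1)] x c g(2) by blast
      then show "x \<in> \<Union>E" using c insert.prems(3) unfolding E_def by auto
    qed
    have "carrier G \<subseteq> \<Union>\<C>'"
    proof
      fix x assume x: "x \<in> carrier G"
      then obtain c where c: "c \<in> \<C>" "x \<in> c" using cov by auto
      show "x \<in> \<Union>\<C>'"
      proof (cases "c \<in> lcosets K")
        case False
        then show ?thesis
          using c insert.prems(3) unfolding \<C>'_def E_def by auto
      next
        case True
        have fc: "f c \<in> carrier G" "c = f c <# K" using f[OF True] by auto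
        then obtain k where k: "k \<in> K" "x = f c \<otimes> k"
          using c(2) unfolding l_coset_def by auto
        have kG: "k \<in> carrier G" using k(1) K(1) subgroup.mem_carrier by metis
        have "g \<otimes> k \<in> \<Union>E" using gK k(1) unfolding l_coset_def by auto
        then obtain e where e: "e \<in> E" "g \<otimes> k \<in> e" by auto
        have "x = (f c \<otimes> inv g) \<otimes> (g \<otimes> k)"
          using k(2) fc(1) g(1) kG by (simp add: m_assoc inv_solve_left)
        then have "x \<in> (f c \<otimes> inv g) <# e" using e(2) unfolding l_coset_def by auto
        then show ?thesis using e(1) c(1) True unfolding \<C>'_def by auto
      qed
    qed
    with not_cov show False by simp
  qed
qed

text \<open>
  Members of the family need only be contained in cosets of infinite index, which is how
  multiplicative cosets enter the additive picture.
\<close>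

corollary (in group) not_covered_by_infinite_index_cosets:
  assumes "finite \<C>"
    and "\<And>c. c \<in> \<C> \<Longrightarrow> \<exists>K. subgroup K G \<and> infinite (lcosets K) \<and> (\<exists>a \<in> carrier G. c \<subseteq> a <# K)"
  shows "\<not> carrier G \<subseteq> \<Union>\<C>"
proof -
  from assms(2) obtain K where K: "\<And>c. c \<in> \<C> \<Longrightarrow> subgroup (K c) G \<and> infinite (lcosets (K c))
      \<and> (\<exists>a \<in> carrier G. c \<subseteq> a <# K c)"
    by metis
  then obtain a where a: "\<And>c. c \<in> \<C> \<Longrightarrow> a c \<in> carrier G \<and> c \<subseteq> a c <# K c"
    by metis
  have "\<not> carrier G \<subseteq> \<Union>((\<lambda>c. a c <# K c) ` \<C>)"
  proof (rule Neumann_covering)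
    show "finite (K ` \<C>)" "finite ((\<lambda>c. a c <# K c) ` \<C>)" using assms(1) by auto
    show "subgroup L G \<and> infinite (lcosets L)" if "L \<in> K ` \<C>" for L using K that by auto
    have "a c <# K c \<in> lcosets (K c)" if "c \<in> \<C>" for c using a[OF that] by (auto simp: LCOSETS_def)
    then show "(\<lambda>c. a c <# K c) ` \<C> \<subseteq> (\<Union>L\<in>K ` \<C>. lcosets L)" by auto
  qed
  moreover have "\<Union>\<C> \<subseteq> \<Union>((\<lambda>c. a c <# K c) ` \<C>)" using a by blast
  ultimately show ?thesis by blast
qed

lemma (in group) finite_subgroup_infinite_index:
  assumes "infinite (carrier G)" and "subgroup K G" and "finite K"
  shows "infinite (lcosets K)"
proof
  assume "finite (lcosets K)"
  moreover have "finite c" if "c \<in> lcosets K" for c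
    using that assms(3) by (auto simp: LCOSETS_def l_coset_def)
  ultimately have "finite (\<Union>(lcosets K))" by blast
  then show False using lcosets_part_G[OF assms(2)] assms(1) by simp
qed

lemma (in group) infinite_index_inj_hom_image:
  assumes f: "f \<in> hom G G" "inj_on f (carrier G)"
    and K: "subgroup K G" "infinite (lcosets K)"
  shows "infinite (lcosets (f ` K))"
proof -
  have KG: "K \<subseteq> carrier G" using K(1) by (rule subgroup.subset)
  have "f ` (a <# K) = f a <# (f ` K)" if "a \<in> carrier G" for a
  proof -
    have "f (a \<otimes> k) = f a \<otimes> f k" if "k \<in> K" for k
      using f(1) KG \<open>a \<in> carrier G\<close> that by (auto simp: hom_mult)
    then show ?thesis by (simp add: l_coset_def image_UN)
  qed
  then have sub: "(`) f ` (lcosets K) \<subseteq> lcosets (f ` K)"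
    using hom_in_carrier[OF f(1)] by (fastforce simp: LCOSETS_def)
  have "inj_on ((`) f) (lcosets K)"
    using inj_on_image_Pow[OF f(2)] lcosets_subset_PowG[OF K(1)] by (rule inj_on_subset)
  then show ?thesis using K(2) sub by (metis finite_imageD finite_subset)
qed

section \<open>Subskew fields inside the additive group\<close>

text \<open>
  For infinite \<open>H\<close>, a fixed \<open>y \<notin> H\<close> yields a distinct coset of \<open>y h\<close> for each \<open>h \<in> H\<close>: a coincidence
  of two of them puts some \<open>y d\<close> with \<open>0 \<noteq> d \<in> H\<close> into \<open>H\<close>, and \<open>d\<close> is invertible inside \<open>H\<close>.
\<close>

lemma proper_subskew_field_infinite_index:
  fixes R (structure)
  assumes R: "skew_field R" "infinite (carrier R)" and H: "proper_subskew_field H R"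
  shows "infinite (lcosets\<^bsub>add_monoid R\<^esub> H)"
proof -
  interpret skew_field R by fact
  have sub: "subring H R" and skew: "subskew_field H R" and "H \<noteq> carrier R"
    using H by (auto simp: proper_subskew_field_def subskew_field_def)
  interpret H: subring H R by fact
  have add: "subgroup H (add_monoid R)" by (rule H.subgroup_axioms)
  show ?thesis
  proof (cases "finite H")
    case True
    then show ?thesis using add.finite_subgroup_infinite_index[OF _ add] R(2) by simp
  next
    case False
    have HR: "H \<subseteq> carrier R" by (rule subringE(1)[OF sub])
    then obtain y where y: "y \<in> carrier R" "y \<notin> H" using \<open>H \<noteq> carrier R\<close> by auto
    have "inj_on (\<lambda>h. (y \<otimes> h) <+ H) H"
    proof (rule inj_onI, rule ccontr)
      fix h h' assume h: "h \<in> H" "h' \<in> H" "(y \<otimes> h) <+ H = (y \<otimes> h') <+ H" "h \<noteq> h'"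
      have c: "h \<in> carrier R" "h' \<in> carrier R" using h HR by auto
      have "y \<otimes> h \<in> (y \<otimes> h) <+ H"
        using add.lcos_self[OF _ add] y(1) c by (simp add: a_l_coset_def)
      then obtain k where k: "k \<in> H" "y \<otimes> h = y \<otimes> h' \<oplus> k"
        using h(3) by (auto simp: a_l_coset_def')
      have kc: "k \<in> carrier R" using k(1) HR by auto
      define d where "d = h \<ominus> h'"
      have dH: "d \<in> H"
        using h unfolding d_def a_minus_def by (simp add: subringE(5,7)[OF sub])
      have d0: "d \<noteq> \<zero>" using h(4) c by (simp add: d_def)
      have dc: "d \<in> carrier R" using dH HR by auto
      have yd: "y \<otimes> d = k"
      proof -
        have "y \<otimes> d = y \<otimes> h \<ominus> y \<otimes> h'"
          unfolding d_def using y(1) c by (simp add: r_distr a_minus_def r_minus)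
        also have "\<dots> = k"
          unfolding k(2) using y(1) c kc by (simp add: a_minus_def a_ac r_neg r_neg1 r_neg2)
        finally show ?thesis .
      qed
      have "d \<in> Units (R\<lparr>carrier := H\<rparr>)"
        using sub_units_eq[OF skew] dH d0 by (simp add: sub_units_def)
      then obtain e where e: "e \<in> H" "d \<otimes> e = \<one>" by (auto simp: Units_def)
      have ec: "e \<in> carrier R" using e(1) HR by auto
      have "y = y \<otimes> (d \<otimes> e)" using e(2) y(1) by simp
      also have "\<dots> = k \<otimes> e" using yd y(1) dc ec by (simp add: m_assoc[symmetric])
      finally have "y \<in> H" using subringE(6)[OF sub k(1) e(1)] by simp
      with y(2) show False by simp
    qed
    then have "infinite ((\<lambda>h. (y \<otimes> h) <+ H) ` H)" using False by (simp add: finite_image_iff)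
    moreover have "(\<lambda>h. (y \<otimes> h) <+ H) ` H \<subseteq> lcosets\<^bsub>add_monoid R\<^esub> H"
      using y(1) HR by (fastforce simp: LCOSETS_def a_l_coset_def)
    ultimately show ?thesis by (metis finite_subset)
  qed
qed

text \<open>
  The maps \<open>f\<close> of interest are left and right multiplication by a unit. An injective endomorphism of
  the additive group transports distinct cosets of \<open>H\<close> to distinct cosets of \<open>f ` H\<close>, so the latter
  inherits the infinite index. As \<open>0\<close> is the only
  nonunit, adjoining the trivial subgroup turns a cover of the units into one of the additive group.
\<close>

lemma units_not_covered_by_images:
  fixes R (structure)
  assumes R: "skew_field R" "infinite (carrier R)"
    and "finite \<C>"
    and \<C>: "\<And>c. c \<in> \<C> \<Longrightarrow> \<exists>H f. proper_subskew_field H R \<and> c \<subseteq> f ` H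
        \<and> f \<in> hom (add_monoid R) (add_monoid R) \<and> inj_on f (carrier R)"
  shows "Units R \<noteq> \<Union>\<C>"
proof
  assume cov: "Units R = \<Union>\<C>"
  interpret skew_field R by fact
  have "\<not> carrier R \<subseteq> \<Union>(insert {\<zero>} \<C>)"
  proof (rule add.not_covered_by_infinite_index_cosets)
    show "finite (insert {\<zero>} \<C>)" using \<open>finite \<C>\<close> by simp
    fix c assume c: "c \<in> insert {\<zero>} \<C>"
    have "\<exists>K. subgroup K (add_monoid R) \<and> infinite (lcosets\<^bsub>add_monoid R\<^esub> K) \<and> c \<subseteq> K"
    proof (cases "c = {\<zero>}")
      case True
      have "subgroup {\<zero>} (add_monoid R)" using add.triv_subgroup by simp
      then show ?thesis using add.finite_subgroup_infinite_index R(2) True by auto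
    next
      case False
      then have "c \<in> \<C>" using c by simp
      then obtain H f where H: "proper_subskew_field H R" "c \<subseteq> f ` H"
          and f: "f \<in> hom (add_monoid R) (add_monoid R)" "inj_on f (carrier R)"
        using \<C> by metis
      have "subring H R" using H(1) by (auto simp: proper_subskew_field_def subskew_field_def)
      then have "subgroup H (add_monoid R)" by (rule subring.axioms(1))
      moreover from this have "subgroup (f ` H) (add_monoid R)"
        using f(1) by (intro group_hom.subgroup_img_is_subgroup[of "add_monoid R" "add_monoid R" f])
          (auto simp: group_hom_def group_hom_axioms_def)
      ultimately show ?thesis
        using add.infinite_index_inj_hom_image[OF f(1)] f(2) H(2)
          proper_subskew_field_infinite_index[OF R H(1)] by auto
    qed
    then obtain K where K: "subgroup K (add_monoid R)" "infinite (lcosets\<^bsub>add_monoid R\<^esub> K)" "c \<subseteq> K"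
      by blast
    have "c \<subseteq> \<zero> <#\<^bsub>add_monoid R\<^esub> K"
      using K(3) add.lcos_mult_one subgroup.subset[OF K(1)] by simp
    then show "\<exists>K. subgroup K (add_monoid R) \<and> infinite (lcosets\<^bsub>add_monoid R\<^esub> K)
        \<and> (\<exists>a\<in>carrier R. c \<subseteq> a <#\<^bsub>add_monoid R\<^esub> K)"
      using K by auto
  qed
  then show False using cov skew_field_Units by auto
qed

theorem theorem3:
  fixes R :: "('a, 'b) ring_scheme"
    and H :: "nat \<Rightarrow> 'a set"
    and t :: nat
  assumes "skew_field R"
    and "infinite (carrier R)"
    and "\<And>i. i \<in> {1..t} \<Longrightarrow> proper_subskew_field (H i) R"
  shows
    "(\<nexists>\<C>. finite \<C> \<and> \<C> \<subseteq> {a <+\<^bsub>R\<^esub> H i | a i. a \<in> carrier R \<and> i \<in> {1..t}}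
        \<and> carrier R = \<Union>\<C>) \<and>
     (\<nexists>\<C>. finite \<C> \<and> \<C> \<subseteq> {a <#\<^bsub>units_of R\<^esub> sub_units R (H i) | a i. a \<in> carrier (units_of R) \<and> i \<in> {1..t}}
        \<and> carrier (units_of R) = \<Union>\<C>) \<and>
     (\<nexists>\<C>. finite \<C> \<and> \<C> \<subseteq> {sub_units R (H i) #>\<^bsub>units_of R\<^esub> a | a i. a \<in> carrier (units_of R) \<and> i \<in> {1..t}}
        \<and> carrier (units_of R) = \<Union>\<C>)"
proof -
  interpret skew_field R by fact
  have sub: "subring (H i) R" if "i \<in> {1..t}" for i
    using assms(3)[OF that] by (auto simp: proper_subskew_field_def subskew_field_def)
  have units: "sub_units R (H i) \<subseteq> H i" for i by (auto simp: sub_units_def Units_def)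
  have unit_carrier: "carrier (units_of R) = Units R" by (simp add: units_of_carrier)
  have "carrier R \<noteq> \<Union>\<C>"
    if \<C>: "finite \<C>" "\<C> \<subseteq> {a <+\<^bsub>R\<^esub> H i | a i. a \<in> carrier R \<and> i \<in> {1..t}}" for \<C>
  proof -
    have "\<not> carrier R \<subseteq> \<Union>\<C>"
    proof (rule add.not_covered_by_infinite_index_cosets[OF \<C>(1)])
      fix c assume "c \<in> \<C>"
      then obtain a i where "c = a <+\<^bsub>R\<^esub> H i" "a \<in> carrier R" "i \<in> {1..t}" using \<C>(2) by blast
      then have "subgroup (H i) (add_monoid R)" "infinite (lcosets\<^bsub>add_monoid R\<^esub> H i)"
          "\<exists>a\<in>carrier R. c \<subseteq> a <#\<^bsub>add_monoid R\<^esub> H i"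
        using subring.axioms(1)[OF sub] proper_subskew_field_infinite_index[OF assms(1,2) assms(3)]
        by (auto simp: a_l_coset_def)
      then show "\<exists>K. subgroup K (add_monoid R) \<and> infinite (lcosets\<^bsub>add_monoid R\<^esub> K)
          \<and> (\<exists>a\<in>carrier R. c \<subseteq> a <#\<^bsub>add_monoid R\<^esub> K)"
        by blast
    qed
    then show ?thesis by auto
  qed
  moreover have "Units R \<noteq> \<Union>\<C>"
    if \<C>: "finite \<C>"
      "\<C> \<subseteq> {a <#\<^bsub>units_of R\<^esub> sub_units R (H i) | a i. a \<in> Units R \<and> i \<in> {1..t}}" for \<C>
  proof (rule units_not_covered_by_images[OF assms(1,2) \<C>(1)])
    fix c assume "c \<in> \<C>"
    then obtain a i where c: "c = a <#\<^bsub>units_of R\<^esub> sub_units R (H i)" "a \<in> Units R" "i \<in> {1..t}"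
      using \<C>(2) by blast
    have "c \<subseteq> (\<lambda>x. a \<otimes>\<^bsub>R\<^esub> x) ` H i"
      using c(1) units by (auto simp: l_coset_def units_of_def)
    moreover have "(\<lambda>x. a \<otimes>\<^bsub>R\<^esub> x) \<in> hom (add_monoid R) (add_monoid R)"
      using c(2) by (auto simp: hom_def r_distr)
    moreover have "inj_on (\<lambda>x. a \<otimes>\<^bsub>R\<^esub> x) (carrier R)"
      using c(2) by (auto intro: inj_onI)
    ultimately show "\<exists>H f. proper_subskew_field H R \<and> c \<subseteq> f ` H
        \<and> f \<in> hom (add_monoid R) (add_monoid R) \<and> inj_on f (carrier R)"
      using assms(3)[OF c(3)] by blast
  qed
  moreover have "Units R \<noteq> \<Union>\<C>"
    if \<C>: "finite \<C>"
      "\<C> \<subseteq> {sub_units R (H i) #>\<^bsub>units_of R\<^esub> a | a i. a \<in> Units R \<and> i \<in> {1..t}}" for \<C>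
  proof (rule units_not_covered_by_images[OF assms(1,2) \<C>(1)])
    fix c assume "c \<in> \<C>"
    then obtain a i where c: "c = sub_units R (H i) #>\<^bsub>units_of R\<^esub> a" "a \<in> Units R" "i \<in> {1..t}"
      using \<C>(2) by blast
    have "c \<subseteq> (\<lambda>x. x \<otimes>\<^bsub>R\<^esub> a) ` H i"
      using c(1) units by (auto simp: r_coset_def units_of_def)
    moreover have "(\<lambda>x. x \<otimes>\<^bsub>R\<^esub> a) \<in> hom (add_monoid R) (add_monoid R)"
      using c(2) by (auto simp: hom_def l_distr)
    moreover have "inj_on (\<lambda>x. x \<otimes>\<^bsub>R\<^esub> a) (carrier R)"
      by (rule inj_on_inverseI[of _ "\<lambda>x. x \<otimes>\<^bsub>R\<^esub> inv\<^bsub>R\<^esub> a"])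
        (use c(2) in \<open>simp add: m_assoc Units_closed\<close>)
    ultimately show "\<exists>H f. proper_subskew_field H R \<and> c \<subseteq> f ` H
        \<and> f \<in> hom (add_monoid R) (add_monoid R) \<and> inj_on f (carrier R)"
      using assms(3)[OF c(3)] by blast
  qed
  ultimately show ?thesis unfolding unit_carrier by blast
qed

end
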